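(* Let $(X,r)$ be a set-theoretic solution of the Yang--Baxter equation, and write $r(x,y)=(\sigma_x(y),\gamma_y(x))$. Let $\pi\colon M(X,r)\to A(X,r)$ be the unique $1$-cocycle with respect to $\lambda'$ such that $\pi(x)=x$ for all $x\in X$, and let $\pi'\colon M(X,r)\to A'(X,r)$ be the unique $1$-cocycle with respect to $\rho'$ such that $\pi'(x)=x$ for all $x\in X$. Then: (i) $\pi$ is surjective if and only if $\sigma_x$ is surjective for all $x\in X$; (ii) $\pi'$ is surjective if and only if $\gamma_x$ is surjective for all $x\in X$.
   Context: A set-theoretic solution of the Yang--Baxter equation (YBE) is a pair $(X,r)$ with $X$ a non-empty set (possibly infinite) and $r\colon X\times X\to X\times X$ a map (not necessarily bijective) such that $(r\times \mathrm{id}_X)\circ(\mathrm{id}_X\times r)\circ(r\times \mathrm{id}_X)=(\mathrm{id}_X\times r)\circ(r\times \mathrm{id}_X)\circ(\mathrm{id}_X\times r)$. The structure monoid is the monoid with presentation $M(X,r)=\langle X\mid x\circ y=\sigma_x(y)\circ\gamma_y(x),\ x,y\in X\rangle$ (operation $\circ$, identity $1$). The left derived structure monoid is $A(X,r)=\langle X\mid x+\sigma_x(y)=\sigma_x(y)+\sigma_{\sigma_x(y)}\gamma_y(x),\ x,y\in X\rangle$ (operation $+$, not necessarily commutative, identity $0$). The right derived structure monoid is $A'(X,r)=\langle X\mid \gamma_y(x)\oplus y=\gamma_{\gamma_y(x)}\sigma_x(y)\oplus\gamma_y(x),\ x,y\in X\rangle$ (operation $\oplus$, not necessarily commutative, identity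 $0'$). $X$ is regarded as a subset of each of these monoids. $\lambda'\colon M(X,r)\to\operatorname{End}(A(X,r))$, $a\mapsto\lambda'_a$, is the unique monoid homomorphism with $\lambda'_x(y)=\sigma_x(y)$ for all $x,y\in X$, and $\rho'\colon M(X,r)\to\operatorname{End}(A'(X,r))$, $a\mapsto\rho'_a$, is the unique monoid anti-homomorphism with $\rho'_x(y)=\gamma_x(y)$ for all $x,y\in X$ (these exist for every set-theoretic solution). A map $\pi\colon M(X,r)\to A(X,r)$ is a $1$-cocycle with respect to $\lambda'$ if $\pi(a\circ b)=\pi(a)+\lambda'_a(\pi(b))$ for all $a,b$. A map $\pi'\colon M(X,r)\to A'(X,r)$ is a $1$-cocycle with respect to $\rho'$ if $\pi'(a\circ b)=\rho'_b(\pi'(a))\oplus\pi'(b)$ for all $a,b$. For every set-theoretic solution there exist unique such $1$-cocycles fixing every $x\in X$. *)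

theory Defs
  imports "HOL-Algebra.Group"
begin

section \<open>Set-theoretic solutions of the Yang--Baxter equation\<close>

text \<open>The underlying set \<open>X\<close> is the whole type \<open>'a\<close>, which is non-empty and may be infinite.
  Triples are nested to the right, so \<open>id \<times> r\<close> is \<open>map_prod id r\<close>, whereas \<open>r \<times> id\<close> needs
  reassociation.\<close>

definition r_id :: "('a \<times> 'a \<Rightarrow> 'a \<times> 'a) \<Rightarrow> 'a \<times> 'a \<times> 'a \<Rightarrow> 'a \<times> 'a \<times> 'a" where
  "r_id r = (\<lambda>(x, y, z). case r (x, y) of (u, v) \<Rightarrow> (u, v, z))"

definition id_r :: "('a \<times> 'a \<Rightarrow> 'a \<times> 'a) \<Rightarrow> 'a \<times> 'a \<times> 'a \<Rightarrow> 'a \<times> 'a \<times> 'a" where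
  "id_r r = map_prod id r"

definition YBE_solution :: "('a \<times> 'a \<Rightarrow> 'a \<times> 'a) \<Rightarrow> bool" where
  "YBE_solution r \<longleftrightarrow> r_id r \<circ> id_r r \<circ> r_id r = id_r r \<circ> r_id r \<circ> id_r r"

text \<open>\<open>r (x, y) = (\<sigma>\<^sub>x y, \<gamma>\<^sub>y x)\<close>: the first argument of \<open>sigma r\<close> and \<open>gamma r\<close> is the index.\<close>

definition sigma :: "('a \<times> 'a \<Rightarrow> 'a \<times> 'a) \<Rightarrow> 'a \<Rightarrow> 'a \<Rightarrow> 'a" where
  "sigma r x y = fst (r (x, y))"

definition gamma :: "('a \<times> 'a \<Rightarrow> 'a \<times> 'a) \<Rightarrow> 'a \<Rightarrow> 'a \<Rightarrow> 'a" where
  "gamma r y x = snd (r (x, y))"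

section \<open>Monoid presentations\<close>

text \<open>The least congruence on the free monoid \<open>'a list\<close> that contains the relations \<open>R\<close>.\<close>

inductive_set pres_cong :: "('a list \<times> 'a list) set \<Rightarrow> ('a list \<times> 'a list) set"
  for R :: "('a list \<times> 'a list) set" where
  base: "(u, v) \<in> R \<Longrightarrow> (u, v) \<in> pres_cong R"
| refl: "(u, u) \<in> pres_cong R"
| sym: "(u, v) \<in> pres_cong R \<Longrightarrow> (v, u) \<in> pres_cong R"
| trans: "(u, v) \<in> pres_cong R \<Longrightarrow> (v, w) \<in> pres_cong R \<Longrightarrow> (u, w) \<in> pres_cong R"
| append: "(u, v) \<in> pres_cong R \<Longrightarrow> (u', v') \<in> pres_cong R \<Longrightarrow> (u @ u', v @ v') \<in> pres_cong R"

definition pres_monoid :: "('a list \<times> 'a list) set \<Rightarrow> 'a list set monoid" where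
  "pres_monoid R = \<lparr>carrier = UNIV // pres_cong R,
     mult = (\<lambda>C D. \<Union>u\<in>C. \<Union>v\<in>D. pres_cong R `` {u @ v}),
     one = pres_cong R `` {[]}\<rparr>"

definition pres_gen :: "('a list \<times> 'a list) set \<Rightarrow> 'a \<Rightarrow> 'a list set" where
  "pres_gen R x = pres_cong R `` {[x]}"

definition structure_rels :: "('a \<times> 'a \<Rightarrow> 'a \<times> 'a) \<Rightarrow> ('a list \<times> 'a list) set" where
  "structure_rels r = {([x, y], [sigma r x y, gamma r y x]) | x y. True}"

definition left_derived_rels :: "('a \<times> 'a \<Rightarrow> 'a \<times> 'a) \<Rightarrow> ('a list \<times> 'a list) set" where
  "left_derived_rels r =
     {([x, sigma r x y], [sigma r x y, sigma r (sigma r x y) (gamma r y x)]) | x y. True}"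

definition right_derived_rels :: "('a \<times> 'a \<Rightarrow> 'a \<times> 'a) \<Rightarrow> ('a list \<times> 'a list) set" where
  "right_derived_rels r =
     {([gamma r y x, y], [gamma r (gamma r y x) (sigma r x y), gamma r y x]) | x y. True}"

abbreviation structure_monoid :: "('a \<times> 'a \<Rightarrow> 'a \<times> 'a) \<Rightarrow> 'a list set monoid" where
  "structure_monoid r \<equiv> pres_monoid (structure_rels r)"

abbreviation left_derived_monoid :: "('a \<times> 'a \<Rightarrow> 'a \<times> 'a) \<Rightarrow> 'a list set monoid" where
  "left_derived_monoid r \<equiv> pres_monoid (left_derived_rels r)"

abbreviation right_derived_monoid :: "('a \<times> 'a \<Rightarrow> 'a \<times> 'a) \<Rightarrow> 'a list set monoid" where
  "right_derived_monoid r \<equiv> pres_monoid (right_derived_rels r)"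

abbreviation M_gen :: "('a \<times> 'a \<Rightarrow> 'a \<times> 'a) \<Rightarrow> 'a \<Rightarrow> 'a list set" where
  "M_gen r \<equiv> pres_gen (structure_rels r)"

abbreviation A_gen :: "('a \<times> 'a \<Rightarrow> 'a \<times> 'a) \<Rightarrow> 'a \<Rightarrow> 'a list set" where
  "A_gen r \<equiv> pres_gen (left_derived_rels r)"

abbreviation A'_gen :: "('a \<times> 'a \<Rightarrow> 'a \<times> 'a) \<Rightarrow> 'a \<Rightarrow> 'a list set" where
  "A'_gen r \<equiv> pres_gen (right_derived_rels r)"

section \<open>Monoid homomorphisms, endomorphism monoids, cocycles\<close>

text \<open>The library's \<^term>\<open>hom\<close> does not require preservation of the identity.\<close>

definition monoid_hom :: "('a, 'c) monoid_scheme \<Rightarrow> ('b, 'd) monoid_scheme \<Rightarrow> ('a \<Rightarrow> 'b) set" where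
  "monoid_hom G H = {h \<in> hom G H. h \<one>\<^bsub>G\<^esub> = \<one>\<^bsub>H\<^esub>}"

definition monoid_antihom :: "('a, 'c) monoid_scheme \<Rightarrow> ('b, 'd) monoid_scheme \<Rightarrow> ('a \<Rightarrow> 'b) set" where
  "monoid_antihom G H = {h \<in> carrier G \<rightarrow> carrier H.
     (\<forall>a\<in>carrier G. \<forall>b\<in>carrier G. h (a \<otimes>\<^bsub>G\<^esub> b) = h b \<otimes>\<^bsub>H\<^esub> h a) \<and> h \<one>\<^bsub>G\<^esub> = \<one>\<^bsub>H\<^esub>}"

text \<open>Endomorphisms are represented by extensional functions, as in \<open>HOL-Algebra.Bij\<close>, so that the
  monoid laws of composition hold as equations between functions.\<close>

definition End_monoid :: "('a, 'c) monoid_scheme \<Rightarrow> ('a \<Rightarrow> 'a) monoid" where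
  "End_monoid G = \<lparr>carrier = monoid_hom G G \<inter> extensional (carrier G),
     mult = compose (carrier G),
     one = (\<lambda>x\<in>carrier G. x)\<rparr>"

definition left_cocycle ::
  "('a, 'c) monoid_scheme \<Rightarrow> ('b, 'd) monoid_scheme \<Rightarrow> ('a \<Rightarrow> 'b \<Rightarrow> 'b) \<Rightarrow> ('a \<Rightarrow> 'b) \<Rightarrow> bool" where
  "left_cocycle M A l p \<longleftrightarrow> p \<in> carrier M \<rightarrow> carrier A \<and>
     (\<forall>a\<in>carrier M. \<forall>b\<in>carrier M. p (a \<otimes>\<^bsub>M\<^esub> b) = p a \<otimes>\<^bsub>A\<^esub> l a (p b))"

definition right_cocycle ::
  "('a, 'c) monoid_scheme \<Rightarrow> ('b, 'd) monoid_scheme \<Rightarrow> ('a \<Rightarrow> 'b \<Rightarrow> 'b) \<Rightarrow> ('a \<Rightarrow> 'b) \<Rightarrow> bool" where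
  "right_cocycle M A \<rho> p \<longleftrightarrow> p \<in> carrier M \<rightarrow> carrier A \<and>
     (\<forall>a\<in>carrier M. \<forall>b\<in>carrier M. p (a \<otimes>\<^bsub>M\<^esub> b) = \<rho> b (p a) \<otimes>\<^bsub>A\<^esub> p b)"

text \<open>The properties that characterise \<open>\<lambda>'\<close>, \<open>\<rho>'\<close>, \<open>\<pi>\<close> and \<open>\<pi>'\<close>; they determine these maps on the
  carrier of the structure monoid.\<close>

definition is_lambda' ::
  "('a \<times> 'a \<Rightarrow> 'a \<times> 'a) \<Rightarrow> ('a list set \<Rightarrow> 'a list set \<Rightarrow> 'a list set) \<Rightarrow> bool" where
  "is_lambda' r l \<longleftrightarrow>
     l \<in> monoid_hom (structure_monoid r) (End_monoid (left_derived_monoid r)) \<and>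
     (\<forall>x y. l (M_gen r x) (A_gen r y) = A_gen r (sigma r x y))"

definition is_rho' ::
  "('a \<times> 'a \<Rightarrow> 'a \<times> 'a) \<Rightarrow> ('a list set \<Rightarrow> 'a list set \<Rightarrow> 'a list set) \<Rightarrow> bool" where
  "is_rho' r \<rho> \<longleftrightarrow>
     \<rho> \<in> monoid_antihom (structure_monoid r) (End_monoid (right_derived_monoid r)) \<and>
     (\<forall>x y. \<rho> (M_gen r x) (A'_gen r y) = A'_gen r (gamma r x y))"

definition is_pi ::
  "('a \<times> 'a \<Rightarrow> 'a \<times> 'a) \<Rightarrow> ('a list set \<Rightarrow> 'a list set \<Rightarrow> 'a list set) \<Rightarrow>
   ('a list set \<Rightarrow> 'a list set) \<Rightarrow> bool" where
  "is_pi r l p \<longleftrightarrow>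
     left_cocycle (structure_monoid r) (left_derived_monoid r) l p \<and>
     (\<forall>x. p (M_gen r x) = A_gen r x)"

definition is_pi' ::
  "('a \<times> 'a \<Rightarrow> 'a \<times> 'a) \<Rightarrow> ('a list set \<Rightarrow> 'a list set \<Rightarrow> 'a list set) \<Rightarrow>
   ('a list set \<Rightarrow> 'a list set) \<Rightarrow> bool" where
  "is_pi' r \<rho> p \<longleftrightarrow>
     right_cocycle (structure_monoid r) (right_derived_monoid r) \<rho> p \<and>
     (\<forall>x. p (M_gen r x) = A'_gen r x)"

section \<open>Existence of these maps\<close>

lemma YBE_sigma:
  assumes "YBE_solution r"
  shows "sigma r x (sigma r y z) = sigma r (sigma r x y) (sigma r (gamma r y x) z)"
    and "gamma r (sigma r (gamma r y x) z) (sigma r x y)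
       = sigma r (gamma r (sigma r y z) x) (gamma r z y)"
    and "gamma r z (gamma r y x) = gamma r (gamma r z y) (gamma r (sigma r y z) x)"
  using fun_cong[OF assms[unfolded YBE_solution_def], of "(x, y, z)"]
  by (auto simp: r_id_def id_r_def sigma_def gamma_def split: prod.splits) (metis fst_conv snd_conv)+

lemma equiv_pres_cong: "equiv UNIV (pres_cong R)"
  by (rule equivI) (auto simp: refl_on_def intro: symI transI pres_cong.intros)

definition cls :: "('a list \<times> 'a list) set \<Rightarrow> 'a list \<Rightarrow> 'a list set" where
  "cls R w = pres_cong R `` {w}"

lemma cls_eq_iff: "cls R u = cls R v \<longleftrightarrow> (u, v) \<in> pres_cong R"
  unfolding cls_def using eq_equiv_class_iff[OF equiv_pres_cong] by blast

lemma carrier_pres: "carrier (pres_monoid R) = range (cls R)"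
  by (auto simp: pres_monoid_def quotient_def cls_def)

lemma one_pres: "\<one>\<^bsub>pres_monoid R\<^esub> = cls R []"
  by (simp add: pres_monoid_def cls_def)

lemma mult_pres: "cls R u \<otimes>\<^bsub>pres_monoid R\<^esub> cls R v = cls R (u @ v)"
proof -
  have "cls R (u' @ v') = cls R (u @ v)" if "u' \<in> cls R u" "v' \<in> cls R v" for u' v'
    using that unfolding cls_eq_iff by (auto simp: cls_def intro: pres_cong.intros)
  moreover have "u \<in> cls R u" "v \<in> cls R v"
    by (auto simp: cls_def intro: pres_cong.refl)
  ultimately show ?thesis
    unfolding pres_monoid_def monoid.simps cls_def[symmetric] by blast
qed

lemma gen_cls: "pres_gen R x = cls R [x]"
  by (simp add: pres_gen_def cls_def)

definition lift :: "('a list \<times> 'a list) set \<Rightarrow> ('a list \<Rightarrow> 'b) \<Rightarrow> 'a list set \<Rightarrow> 'b" where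
  "lift R f C = f (SOME u. C = cls R u)"

lemma lift_cls:
  assumes "\<And>u v. (u, v) \<in> pres_cong R \<Longrightarrow> f u = f v"
  shows "lift R f (cls R u) = f u"
proof -
  have "cls R u = cls R (SOME w. cls R u = cls R w)"
    by (rule someI) (rule HOL.refl)
  then show ?thesis
    using assms unfolding lift_def cls_eq_iff by metis
qed

lemma pres_cong_map:
  assumes "\<And>u v. (u, v) \<in> R \<Longrightarrow> (map f u, map f v) \<in> pres_cong S"
    and "(u, v) \<in> pres_cong R"
  shows "(map f u, map f v) \<in> pres_cong S"
  using assms(2) by induction (auto intro: assms(1) pres_cong.intros)

text \<open>An endomorphism of a presented monoid given by a map on generators.\<close>

definition endo :: "('a list \<times> 'a list) set \<Rightarrow> ('a \<Rightarrow> 'a) \<Rightarrow> 'a list set \<Rightarrow> 'a list set" where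
  "endo R f = restrict (lift R (\<lambda>u. cls R (map f u))) (carrier (pres_monoid R))"

lemma endo_cls:
  assumes "\<And>u v. (u, v) \<in> R \<Longrightarrow> (map f u, map f v) \<in> pres_cong R"
  shows "endo R f (cls R u) = cls R (map f u)"
proof -
  have "lift R (\<lambda>u. cls R (map f u)) (cls R u) = cls R (map f u)"
    by (rule lift_cls) (simp add: cls_eq_iff pres_cong_map[OF assms])
  then show ?thesis
    by (simp add: endo_def carrier_pres)
qed

lemma endo_in_End:
  assumes "\<And>u v. (u, v) \<in> R \<Longrightarrow> (map f u, map f v) \<in> pres_cong R"
  shows "endo R f \<in> carrier (End_monoid (pres_monoid R))"
proof -
  have "endo R f \<in> extensional (carrier (pres_monoid R))"
    by (simp add: endo_def)
  then show ?thesis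
    by (auto simp: End_monoid_def monoid_hom_def hom_def carrier_pres mult_pres one_pres endo_cls[OF assms])
qed

lemma endo_comp:
  assumes "\<And>u v. (u, v) \<in> R \<Longrightarrow> (map f u, map f v) \<in> pres_cong R"
    and "\<And>u v. (u, v) \<in> R \<Longrightarrow> (map g u, map g v) \<in> pres_cong R"
    and h: "h = f \<circ> g"
  shows "endo R h = endo R f \<otimes>\<^bsub>End_monoid (pres_monoid R)\<^esub> endo R g"
proof -
  have fg: "\<And>u v. (u, v) \<in> R \<Longrightarrow> (map (f \<circ> g) u, map (f \<circ> g) v) \<in> pres_cong R"
    using pres_cong_map[OF assms(1) assms(2)] by simp
  have "endo R (f \<circ> g) = compose (carrier (pres_monoid R)) (endo R f) (endo R g)"
  proof (rule extensionalityI[where A = "carrier (pres_monoid R)"])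
    fix C assume "C \<in> carrier (pres_monoid R)"
    then show "endo R (f \<circ> g) C = compose (carrier (pres_monoid R)) (endo R f) (endo R g) C"
      by (auto simp: carrier_pres compose_def endo_cls[OF fg] endo_cls[OF assms(1)] endo_cls[OF assms(2)])
  qed (auto simp: endo_def compose_def)
  then show ?thesis
    using endo_in_End[OF assms(1)] endo_in_End[OF assms(2)] h by (simp add: End_monoid_def)
qed

lemma endo_id: "endo R id = \<one>\<^bsub>End_monoid (pres_monoid R)\<^esub>"
proof -
  have "\<And>u v. (u, v) \<in> R \<Longrightarrow> (map id u, map id v) \<in> pres_cong R"
    by (simp add: pres_cong.base)
  note e = endo_cls[OF this]
  show ?thesis
  proof (rule extensionalityI[where A = "carrier (pres_monoid R)"])
    fix C assume "C \<in> carrier (pres_monoid R)"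
    then show "endo R id C = \<one>\<^bsub>End_monoid (pres_monoid R)\<^esub> C"
      by (auto simp only: End_monoid_def carrier_pres e monoid.simps map_ident list.map_id restrict_apply' rangeI)
  qed (simp_all add: End_monoid_def endo_def)
qed

lemma map_sigma_cong:
  assumes "YBE_solution r" "(u, v) \<in> left_derived_rels r"
  shows "(map (sigma r z) u, map (sigma r z) v) \<in> pres_cong (left_derived_rels r)"
proof -
  obtain x y where uv: "u = [x, sigma r x y]"
      "v = [sigma r x y, sigma r (sigma r x y) (gamma r y x)]"
    using assms(2) by (auto simp: left_derived_rels_def)
  let ?a = "sigma r z x" and ?b = "sigma r (gamma r x z) y"
  have "map (sigma r z) u = [?a, sigma r ?a ?b]"
    by (simp add: uv YBE_sigma(1)[OF assms(1), of z x y])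
  moreover have "map (sigma r z) v = [sigma r ?a ?b, sigma r (sigma r ?a ?b) (gamma r ?b ?a)]"
    using YBE_sigma(1)[OF assms(1), of z x y] YBE_sigma(2)[OF assms(1), where x=z and y=x and z=y]
      YBE_sigma(1)[OF assms(1), of z "sigma r x y" "gamma r y x"]
    by (simp add: uv)
  ultimately show ?thesis
    by (auto intro!: pres_cong.base simp: left_derived_rels_def)
qed

lemma map_gamma_cong:
  assumes "YBE_solution r" "(u, v) \<in> right_derived_rels r"
  shows "(map (gamma r z) u, map (gamma r z) v) \<in> pres_cong (right_derived_rels r)"
proof -
  obtain x y where uv: "u = [gamma r y x, y]"
      "v = [gamma r (gamma r y x) (sigma r x y), gamma r y x]"
    using assms(2) by (auto simp: right_derived_rels_def)
  let ?b = "gamma r z y" and ?a = "gamma r (sigma r y z) x"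
  have "map (gamma r z) u = [gamma r ?b ?a, ?b]"
    by (simp add: uv YBE_sigma(3)[OF assms(1), of z y x])
  moreover have "map (gamma r z) v = [gamma r (gamma r ?b ?a) (sigma r ?a ?b), gamma r ?b ?a]"
    using YBE_sigma(3)[OF assms(1), of z y x] YBE_sigma(2)[OF assms(1), where x=x and y=y and z=z]
      YBE_sigma(3)[OF assms(1), of z "gamma r y x" "sigma r x y"]
    by (simp add: uv)
  ultimately show ?thesis
    by (auto intro!: pres_cong.base simp: right_derived_rels_def)
qed

lemma foldr_sigma_cong:
  assumes "YBE_solution r" "(u, v) \<in> pres_cong (structure_rels r)"
  shows "foldr (sigma r) u = foldr (sigma r) v"
  using assms(2)
  by induction (auto simp: structure_rels_def fun_eq_iff YBE_sigma(1)[OF assms(1), symmetric])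

lemma fold_gamma_cong:
  assumes "YBE_solution r" "(u, v) \<in> pres_cong (structure_rels r)"
  shows "fold (gamma r) u = fold (gamma r) v"
  using assms(2)
  by induction (auto simp: structure_rels_def fun_eq_iff YBE_sigma(3)[OF assms(1), symmetric])

lemma map_foldr_sigma_cong:
  assumes "YBE_solution r" "(u, v) \<in> pres_cong (left_derived_rels r)"
  shows "(map (foldr (sigma r) w) u, map (foldr (sigma r) w) v) \<in> pres_cong (left_derived_rels r)"
proof (induction w)
  case Nil
  then show ?case using assms(2) by (simp add: id_def)
next
  case (Cons x w)
  then show ?case
    using pres_cong_map[OF map_sigma_cong[OF assms(1)] Cons, of x] by (simp add: comp_def)
qed

lemma map_fold_gamma_cong:
  assumes "YBE_solution r" "(u, v) \<in> pres_cong (right_derived_rels r)"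
  shows "(map (fold (gamma r) w) u, map (fold (gamma r) w) v) \<in> pres_cong (right_derived_rels r)"
proof (induction w rule: rev_induct)
  case Nil
  then show ?case using assms(2) by (simp add: id_def)
next
  case (snoc x w)
  then show ?case
    using pres_cong_map[OF map_gamma_cong[OF assms(1)] snoc, of x] by (simp add: comp_def)
qed

fun pi_word :: "('a \<times> 'a \<Rightarrow> 'a \<times> 'a) \<Rightarrow> 'a list \<Rightarrow> 'a list" where
  "pi_word r [] = []"
| "pi_word r (x # w) = x # map (sigma r x) (pi_word r w)"

fun pi'_word :: "('a \<times> 'a \<Rightarrow> 'a \<times> 'a) \<Rightarrow> 'a list \<Rightarrow> 'a list" where
  "pi'_word r [] = []"
| "pi'_word r (x # w) = fold (gamma r) w x # pi'_word r w"

lemma pi_word_append: "pi_word r (u @ v) = pi_word r u @ map (foldr (sigma r) u) (pi_word r v)"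
  by (induction u) (auto simp: id_def)

lemma pi'_word_append: "pi'_word r (u @ v) = map (fold (gamma r) v) (pi'_word r u) @ pi'_word r v"
  by (induction u) auto

lemma pi_word_cong:
  assumes "YBE_solution r" "(u, v) \<in> pres_cong (structure_rels r)"
  shows "(pi_word r u, pi_word r v) \<in> pres_cong (left_derived_rels r)"
  using assms(2)
proof induction
  case (base u v)
  then show ?case
    by (auto simp: structure_rels_def left_derived_rels_def intro!: pres_cong.base)
next
  case (append u v u' v')
  then show ?case
    using map_foldr_sigma_cong[OF assms(1) append.IH(2), of v] foldr_sigma_cong[OF assms(1) append.hyps(1)]
    by (auto simp: pi_word_append intro: pres_cong.append)
qed (auto intro: pres_cong.intros)

lemma pi'_word_cong:
  assumes "YBE_solution r" "(u, v) \<in> pres_cong (structure_rels r)"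
  shows "(pi'_word r u, pi'_word r v) \<in> pres_cong (right_derived_rels r)"
  using assms(2)
proof induction
  case (base u v)
  then show ?case
    by (auto simp: structure_rels_def right_derived_rels_def intro!: pres_cong.base)
next
  case (append u v u' v')
  then show ?case
    using map_fold_gamma_cong[OF assms(1) append.IH(1), of v'] fold_gamma_cong[OF assms(1) append.hyps(2)]
    by (auto simp: pi'_word_append intro: pres_cong.append)
qed (auto intro: pres_cong.intros)

lemma lambda'_pi_exist:
  assumes r: "YBE_solution r"
  shows "\<exists>l p. is_lambda' r l \<and> is_pi r l p"
proof -
  define l where "l = lift (structure_rels r) (\<lambda>w. endo (left_derived_rels r) (foldr (sigma r) w))"
  define p where "p = lift (structure_rels r) (\<lambda>w. cls (left_derived_rels r) (pi_word r w))"
  have l: "l (cls (structure_rels r) w) = endo (left_derived_rels r) (foldr (sigma r) w)" for w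
    unfolding l_def by (rule lift_cls) (simp add: foldr_sigma_cong[OF r])
  have p: "p (cls (structure_rels r) w) = cls (left_derived_rels r) (pi_word r w)" for w
    unfolding p_def by (rule lift_cls) (simp add: cls_eq_iff pi_word_cong[OF r])
  note c = map_foldr_sigma_cong[OF r pres_cong.base]
  note ec = endo_cls[OF c]
  have "l \<in> monoid_hom (structure_monoid r) (End_monoid (left_derived_monoid r))"
    by (auto simp: monoid_hom_def hom_def carrier_pres mult_pres one_pres l
        intro!: endo_in_End c endo_comp simp flip: endo_id)
  moreover have "l (M_gen r x) (A_gen r y) = A_gen r (sigma r x y)" for x y
    by (simp add: gen_cls l ec del: foldr.simps) simp
  ultimately have "is_lambda' r l"
    by (simp add: is_lambda'_def)
  moreover have "is_pi r l p"
    by (auto simp: is_pi_def left_cocycle_def carrier_pres mult_pres gen_cls p l ec pi_word_append)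
  ultimately show ?thesis by blast
qed

lemma rho'_pi'_exist:
  assumes r: "YBE_solution r"
  shows "\<exists>\<rho> p. is_rho' r \<rho> \<and> is_pi' r \<rho> p"
proof -
  define \<rho> where "\<rho> = lift (structure_rels r) (\<lambda>w. endo (right_derived_rels r) (fold (gamma r) w))"
  define p where "p = lift (structure_rels r) (\<lambda>w. cls (right_derived_rels r) (pi'_word r w))"
  have l: "\<rho> (cls (structure_rels r) w) = endo (right_derived_rels r) (fold (gamma r) w)" for w
    unfolding \<rho>_def by (rule lift_cls) (simp add: fold_gamma_cong[OF r])
  have p: "p (cls (structure_rels r) w) = cls (right_derived_rels r) (pi'_word r w)" for w
    unfolding p_def by (rule lift_cls) (simp add: cls_eq_iff pi'_word_cong[OF r])
  note c = map_fold_gamma_cong[OF r pres_cong.base]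
  note ec = endo_cls[OF c]
  have "\<rho> \<in> monoid_antihom (structure_monoid r) (End_monoid (right_derived_monoid r))"
    by (auto simp: monoid_antihom_def carrier_pres mult_pres one_pres l
        intro!: endo_in_End c endo_comp simp flip: endo_id)
  moreover have "\<rho> (M_gen r x) (A'_gen r y) = A'_gen r (gamma r x y)" for x y
    by (simp add: gen_cls l ec del: fold.simps) simp
  ultimately have "is_rho' r \<rho>"
    by (simp add: is_rho'_def)
  moreover have "is_pi' r \<rho> p"
    by (auto simp: is_pi'_def right_cocycle_def carrier_pres mult_pres gen_cls p l ec pi'_word_append)
  ultimately show ?thesis by blast
qed

end

theory Submission
  imports Defs
begin

text \<open>
  On words the cocycle \<open>\<pi>\<close> is \<^const>\<open>pi_word\<close>, which sends \<open>x # w\<close> to \<open>x\<close> followed by the image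
  of \<open>w\<close> with \<open>\<sigma>\<^sub>x\<close> applied letterwise.  If every \<open>\<sigma>\<^sub>x\<close> is surjective, any word can be
  pulled back through this recursion one letter at a time, so \<open>\<pi>\<close> is surjective already on words.

  For the converse, look at words of length two.  Among these, \<^const>\<open>pi_word\<close> takes exactly the
  values \<open>[a, \<sigma>\<^sub>a b]\<close>, and \<^emph>\<open>both\<close> sides of every defining relation of the left derived
  monoid have this form.  Hence a word \<open>[x, y]\<close> not of this form admits no rewriting at all, and its
  class is a singleton; \<open>\<pi>\<close> preserves length and so misses it.  So surjectivity of \<open>\<pi>\<close> makes
  every \<open>[x, y]\<close> of the form \<open>[a, \<sigma>\<^sub>a b]\<close>, that is, \<open>y\<close> lies in the image of \<open>\<sigma>\<^sub>x\<close>.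

  The argument for \<open>\<pi>'\<close> is the mirror image: words are read from the right, and the words
  \<open>[\<gamma>\<^sub>b a, b]\<close> take the place of \<open>[a, \<sigma>\<^sub>a b]\<close>.
\<close>

section \<open>Presentations with quadratic relations\<close>

text \<open>A relation of word length two can act nontrivially on a word of length two only by replacing
  all of it, so two distinct congruent words of length two both occur among the sides of the relations.\<close>

lemma quadratic_pres_cong:
  assumes quadratic: "\<And>u v. (u, v) \<in> R \<Longrightarrow> length u = 2 \<and> length v = 2 \<and> u \<in> S \<and> v \<in> S"
    and "(u, v) \<in> pres_cong R"
  shows "length u = length v \<and> (u = v \<or> 2 \<le> length u \<and> (length u = 2 \<longrightarrow> u \<in> S \<and> v \<in> S))"
  using assms(2)
proof induction
  case (base u v)
  then show ?case using quadratic[of u v] by auto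
next
  case (append u v u' v')
  \<comment> \<open>A nontrivial change next to a further letter makes the word too long for the claim about
    length two; at length two exactly, one of the two factors is therefore empty.\<close>
  have "3 \<le> length (u @ u')" if "u \<noteq> v \<or> u' \<noteq> v'" "u \<noteq> []" "u' \<noteq> []"
  proof -
    have "0 < length u" "0 < length u'"
      using that(2,3) by simp_all
    moreover have "2 \<le> length u \<or> 2 \<le> length u'"
      using append.IH that(1) by blast
    ultimately show ?thesis
      unfolding length_append by linarith
  qed
  moreover have "length (u @ u') = length (v @ v')" "u = [] \<longleftrightarrow> v = []" "u' = [] \<longleftrightarrow> v' = []"
    using append.IH by auto
  ultimately show ?case
    using append.IH by (cases "u = []"; cases "u' = []"; cases "u = v \<and> u' = v'") simp_all
next
  case (trans u v w)
  then show ?case by (cases "u = v"; cases "v = w") simp_all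
qed auto

text \<open>A cocycle sends the identity to an idempotent; by this lemma that forces it to be the identity.\<close>

lemma idempotent_quadratic_pres_monoid:
  assumes quadratic: "\<And>u v. (u, v) \<in> R \<Longrightarrow> length u = 2 \<and> length v = 2"
    and C: "C \<in> carrier (pres_monoid R)" and idem: "C \<otimes>\<^bsub>pres_monoid R\<^esub> C = C"
  shows "C = cls R []"
proof -
  obtain u where u: "C = cls R u"
    using C by (auto simp: carrier_pres)
  have "(u @ u, u) \<in> pres_cong R"
    using idem by (simp add: u mult_pres cls_eq_iff)
  then have "length (u @ u) = length u"
    using quadratic_pres_cong[where R = R and S = UNIV] quadratic by blast
  then show ?thesis by (simp add: u)
qed

lemma monoid_hom_on_word:
  assumes h: "h \<in> monoid_hom (pres_monoid R) (pres_monoid S)"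
    and gen: "\<And>y. h (pres_gen R y) = pres_gen S (f y)"
  shows "h (cls R v) = cls S (map f v)"
proof (induction v)
  case Nil
  then show ?case using h by (simp add: monoid_hom_def one_pres)
next
  case (Cons y v)
  have "h (cls R [y] \<otimes>\<^bsub>pres_monoid R\<^esub> cls R v) = h (cls R [y]) \<otimes>\<^bsub>pres_monoid S\<^esub> h (cls R v)"
    using h by (auto simp: monoid_hom_def hom_def carrier_pres)
  then show ?case
    using Cons gen[of y] by (simp add: mult_pres gen_cls)
qed

section \<open>The cocycles on words\<close>

text \<open>The cocycle identity with a single letter as left factor is the recursion of \<^const>\<open>pi_word\<close>,
  so only the value at the identity needs an argument of its own.\<close>

lemma pi_on_word:
  assumes l: "is_lambda' r l" and p: "is_pi r l p"
  shows "p (cls (structure_rels r) w) = cls (left_derived_rels r) (pi_word r w)"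
proof (induction w)
  let ?M = "structure_monoid r" and ?A = "left_derived_monoid r"
  have cocycle: "p (a \<otimes>\<^bsub>?M\<^esub> b) = p a \<otimes>\<^bsub>?A\<^esub> l a (p b)"
    if "a \<in> carrier ?M" "b \<in> carrier ?M" for a b
    using p that by (simp add: is_pi_def left_cocycle_def)
  {
    case Nil
    let ?e = "cls (structure_rels r) []"
    have pe: "p ?e \<in> carrier ?A"
      using p by (auto simp: is_pi_def left_cocycle_def carrier_pres)
    have "l ?e = (\<lambda>x\<in>carrier ?A. x)"
      using l by (simp add: is_lambda'_def monoid_hom_def one_pres End_monoid_def)
    then have "p ?e \<otimes>\<^bsub>?A\<^esub> p ?e = p ?e"
      using cocycle[of ?e ?e] pe by (simp add: carrier_pres mult_pres)
    moreover have "length u = 2 \<and> length v = 2" if "(u, v) \<in> left_derived_rels r" for u v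
      using that by (auto simp: left_derived_rels_def)
    ultimately have "p ?e = cls (left_derived_rels r) []"
      using idempotent_quadratic_pres_monoid[OF _ pe] by blast
    then show ?case by simp
  next
    case (Cons x w)
    have "l (M_gen r x) \<in> carrier (End_monoid ?A)"
      using l by (auto simp: is_lambda'_def monoid_hom_def hom_def carrier_pres gen_cls)
    then have "l (M_gen r x) \<in> monoid_hom ?A ?A"
      by (simp add: End_monoid_def)
    then have "l (M_gen r x) (cls (left_derived_rels r) v)
        = cls (left_derived_rels r) (map (sigma r x) v)" for v
      using l by (intro monoid_hom_on_word) (auto simp: is_lambda'_def)
    moreover have "p (M_gen r x) = A_gen r x"
      using p by (simp add: is_pi_def)
    ultimately show ?case
      using cocycle[of "M_gen r x" "cls (structure_rels r) w"] Cons
      by (simp add: gen_cls carrier_pres mult_pres)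
  }
qed

text \<open>The right cocycle splits off the last letter of a word, hence the reversed induction.\<close>

lemma pi'_on_word:
  assumes l: "is_rho' r l" and p: "is_pi' r l p"
  shows "p (cls (structure_rels r) w) = cls (right_derived_rels r) (pi'_word r w)"
proof (induction w rule: rev_induct)
  let ?M = "structure_monoid r" and ?A = "right_derived_monoid r"
  have cocycle: "p (a \<otimes>\<^bsub>?M\<^esub> b) = l b (p a) \<otimes>\<^bsub>?A\<^esub> p b"
    if "a \<in> carrier ?M" "b \<in> carrier ?M" for a b
    using p that by (simp add: is_pi'_def right_cocycle_def)
  {
    case Nil
    let ?e = "cls (structure_rels r) []"
    have pe: "p ?e \<in> carrier ?A"
      using p by (auto simp: is_pi'_def right_cocycle_def carrier_pres)
    have "l ?e = (\<lambda>x\<in>carrier ?A. x)"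
      using l by (simp add: is_rho'_def monoid_antihom_def one_pres End_monoid_def)
    then have "p ?e \<otimes>\<^bsub>?A\<^esub> p ?e = p ?e"
      using cocycle[of ?e ?e] pe by (simp add: carrier_pres mult_pres)
    moreover have "length u = 2 \<and> length v = 2" if "(u, v) \<in> right_derived_rels r" for u v
      using that by (auto simp: right_derived_rels_def)
    ultimately have "p ?e = cls (right_derived_rels r) []"
      using idempotent_quadratic_pres_monoid[OF _ pe] by blast
    then show ?case by simp
  next
    case (snoc x w)
    have "l (M_gen r x) \<in> carrier (End_monoid ?A)"
      using l by (auto simp: is_rho'_def monoid_antihom_def carrier_pres gen_cls)
    then have "l (M_gen r x) \<in> monoid_hom ?A ?A"
      by (simp add: End_monoid_def)
    then have "l (M_gen r x) (cls (right_derived_rels r) v)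
        = cls (right_derived_rels r) (map (gamma r x) v)" for v
      using l by (intro monoid_hom_on_word) (auto simp: is_rho'_def)
    moreover have "p (M_gen r x) = A'_gen r x"
      using p by (simp add: is_pi'_def)
    ultimately show ?case
      using cocycle[of "cls (structure_rels r) w" "M_gen r x"] snoc
      by (simp add: gen_cls carrier_pres mult_pres pi'_word_append)
  }
qed

section \<open>Surjectivity\<close>

lemma length_pi_word [simp]: "length (pi_word r w) = length w"
  by (induction w) auto

lemma length_pi'_word [simp]: "length (pi'_word r w) = length w"
  by (induction w) auto

text \<open>The preimage is built from the front: once the first letter \<open>x\<close> is fixed, the remaining letters
  are replaced by preimages under \<open>\<sigma>\<^sub>x\<close>, giving a shorter word to be treated in the same way.\<close>

lemma surj_pi_word:
  assumes "\<And>x. surj (sigma r x)"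
  shows "surj (pi_word r)"
  unfolding surj_def
proof
  fix v
  show "\<exists>w. v = pi_word r w"
  proof (induction v rule: length_induct)
    case (1 v)
    show ?case
    proof (cases v)
      case Nil
      then show ?thesis by (metis pi_word.simps(1))
    next
      case (Cons x v')
      obtain u where u: "v' = map (sigma r x) u"
        using assms[of x] unfolding surj_def by (meson ex_map_conv)
      then have "length u < length v"
        using Cons by auto
      then obtain w where "u = pi_word r w"
        using 1 by metis
      then have "v = pi_word r (x # w)"
        using u Cons by simp
      then show ?thesis ..
    qed
  qed
qed

lemma surj_pi'_word:
  assumes "\<And>x. surj (gamma r x)"
  shows "surj (pi'_word r)"
  unfolding surj_def
proof
  fix v
  show "\<exists>w. v = pi'_word r w"
  proof (induction v rule: length_induct)
    case (1 v)
    show ?case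
    proof (cases v rule: rev_cases)
      case Nil
      then show ?thesis by (metis pi'_word.simps(1))
    next
      case (snoc v' x)
      obtain u where u: "v' = map (gamma r x) u"
        using assms[of x] unfolding surj_def by (meson ex_map_conv)
      then have "length u < length v"
        using snoc by auto
      then obtain w where "u = pi'_word r w"
        using 1 by metis
      then have "v = pi'_word r (w @ [x])"
        using u snoc by (simp add: pi'_word_append)
      then show ?thesis ..
    qed
  qed
qed

lemma length_2_pi_word: "length w = 2 \<Longrightarrow> \<exists>a b. pi_word r w = [a, sigma r a b]"
  by (auto simp: length_Suc_conv numeral_2_eq_2)

lemma length_2_pi'_word: "length w = 2 \<Longrightarrow> \<exists>a b. pi'_word r w = [gamma r b a, b]"
  by (auto simp: length_Suc_conv numeral_2_eq_2)

lemma surj_pi_iff: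
  assumes l: "is_lambda' r l" and p: "is_pi r l p"
  shows "p ` carrier (structure_monoid r) = carrier (left_derived_monoid r)
    \<longleftrightarrow> (\<forall>x. surj (sigma r x))"
proof
  assume surj: "p ` carrier (structure_monoid r) = carrier (left_derived_monoid r)"
  let ?S = "{[a, sigma r a b] | a b. True}"
  have sides: "length u = 2 \<and> length v = 2 \<and> u \<in> ?S \<and> v \<in> ?S"
    if "(u, v) \<in> left_derived_rels r" for u v
    using that by (auto simp: left_derived_rels_def)
  have "y \<in> range (sigma r x)" for x y
  proof -
    have "cls (left_derived_rels r) [x, y] \<in> p ` carrier (structure_monoid r)"
      unfolding surj by (simp add: carrier_pres)
    then obtain w where "cls (left_derived_rels r) [x, y] = cls (left_derived_rels r) (pi_word r w)"
      by (auto simp: carrier_pres pi_on_word[OF l p])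
    then have "([x, y], pi_word r w) \<in> pres_cong (left_derived_rels r)"
      by (simp add: cls_eq_iff)
    \<comment> \<open>Either nothing was rewritten or the word has the shape shared by all sides of relations; both put
      \<open>y\<close> in the image of \<open>\<sigma>\<^sub>x\<close>.\<close>
    from quadratic_pres_cong[OF sides this]
    have "length [x, y] = length (pi_word r w)" "[x, y] = pi_word r w \<or> [x, y] \<in> ?S"
      by auto
    then show ?thesis
      using length_2_pi_word[of w r] by auto
  qed
  then show "\<forall>x. surj (sigma r x)" by blast
next
  assume "\<forall>x. surj (sigma r x)"
  then have surj: "surj (pi_word r)"
    by (simp add: surj_pi_word)
  have "p ` carrier (structure_monoid r) = range (\<lambda>w. cls (left_derived_rels r) (pi_word r w))"
    by (simp only: carrier_pres image_image pi_on_word[OF l p])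
  also have "\<dots> = cls (left_derived_rels r) ` range (pi_word r)"
    by (simp only: image_image)
  also have "\<dots> = carrier (left_derived_monoid r)"
    by (simp only: surj carrier_pres)
  finally show "p ` carrier (structure_monoid r) = carrier (left_derived_monoid r)" .
qed

lemma surj_pi'_iff:
  assumes l: "is_rho' r l" and p: "is_pi' r l p"
  shows "p ` carrier (structure_monoid r) = carrier (right_derived_monoid r)
    \<longleftrightarrow> (\<forall>x. surj (gamma r x))"
proof
  assume surj: "p ` carrier (structure_monoid r) = carrier (right_derived_monoid r)"
  let ?S = "{[gamma r b a, b] | a b. True}"
  have sides: "length u = 2 \<and> length v = 2 \<and> u \<in> ?S \<and> v \<in> ?S"
    if "(u, v) \<in> right_derived_rels r" for u v
    using that by (auto simp: right_derived_rels_def)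
  have "y \<in> range (gamma r x)" for x y
  proof -
    have "cls (right_derived_rels r) [y, x] \<in> p ` carrier (structure_monoid r)"
      unfolding surj by (simp add: carrier_pres)
    then obtain w where "cls (right_derived_rels r) [y, x] = cls (right_derived_rels r) (pi'_word r w)"
      by (auto simp: carrier_pres pi'_on_word[OF l p])
    then have "([y, x], pi'_word r w) \<in> pres_cong (right_derived_rels r)"
      by (simp add: cls_eq_iff)
    from quadratic_pres_cong[OF sides this]
    have "length [y, x] = length (pi'_word r w)" "[y, x] = pi'_word r w \<or> [y, x] \<in> ?S"
      by auto
    then show ?thesis
      using length_2_pi'_word[of w r] by auto
  qed
  then show "\<forall>x. surj (gamma r x)" by blast
next
  assume "\<forall>x. surj (gamma r x)"
  then have surj: "surj (pi'_word r)"
    by (simp add: surj_pi'_word)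
  have "p ` carrier (structure_monoid r) = range (\<lambda>w. cls (right_derived_rels r) (pi'_word r w))"
    by (simp only: carrier_pres image_image pi'_on_word[OF l p])
  also have "\<dots> = cls (right_derived_rels r) ` range (pi'_word r)"
    by (simp only: image_image)
  also have "\<dots> = carrier (right_derived_monoid r)"
    by (simp only: surj carrier_pres)
  finally show "p ` carrier (structure_monoid r) = carrier (right_derived_monoid r)" .
qed

theorem proposition3p6:
  fixes r :: "'a \<times> 'a \<Rightarrow> 'a \<times> 'a"
    and lambda' rho' :: "'a list set \<Rightarrow> 'a list set \<Rightarrow> 'a list set"
    and \<pi> \<pi>' :: "'a list set \<Rightarrow> 'a list set"
  assumes "YBE_solution r"
    and "is_lambda' r lambda'" and "is_pi r lambda' \<pi>"
    and "is_rho' r rho'" and "is_pi' r rho' \<pi>'"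
  shows "(\<pi> ` carrier (structure_monoid r) = carrier (left_derived_monoid r)
            \<longleftrightarrow> (\<forall>x. surj (sigma r x)))
       \<and> (\<pi>' ` carrier (structure_monoid r) = carrier (right_derived_monoid r)
            \<longleftrightarrow> (\<forall>x. surj (gamma r x)))"
  using surj_pi_iff[OF assms(2,3)] surj_pi'_iff[OF assms(4,5)] ..

end
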